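(* For any even integer $p\ge2$ and $z\in\mathbb{C}$, with $r=\frac p2$, the internal stability polynomials of the explicit midpoint extrapolation method are given by $$Q^{\mathrm{EM}}_{p,m,\ell}(z)=\frac{2(-1)^{m+r}m^{2r}}{(r-m)!\,(r+m)!}\,q_{m,2m-\ell+1}(z)\qquad(1\le m\le r,\ 1\le\ell\le2m),$$ where for $1\le m\le r$ the polynomials $q_{m,j}$ are defined by $q_{m,0}(z)=0$, $q_{m,1}(z)=1$ and $q_{m,j}(z)=\frac zm q_{m,j-1}(z)+q_{m,j-2}(z)$ for $2\le j\le2m$.
   Context: Explicit midpoint (EM) extrapolation of even order $p\ge2$, $r=p/2$, on the test equation $U'=\lambda U$, with $z=\tau\lambda\in\mathbb{C}$ and internal perturbations: given $U_n$ and residuals $\tilde r_{m,j}\in\mathbb{C}$ ($1\le m\le r$, $1\le j\le2m$), set $$\widetilde Y_{m,0}=U_n,\quad \widetilde Y_{m,1}=\Big(1+\frac z{2m}\Big)\widetilde Y_{m,0}+\tilde r_{m,1},\quad \widetilde Y_{m,j}=\widetilde Y_{m,j-2}+\frac zm\widetilde Y_{m,j-1}+\tilde r_{m,j}\ (2\le j\le2m),\quad T_{m,1}=\widetilde Y_{m,2m},$$ $$T_{j,k}=T_{j,k-1}+\frac{T_{j,k-1}-T_{j-1,k-1}}{\frac{j^2}{(j-k+1)^2}-1}\quad(2\le k\le j\le r),\qquad U_{n+1}=T_{r,r}.$$ Then $U_{n+1}=P(z)U_n+\sum_{m=1}^r\sum_{\ell=1}^{2m}Q^{\mathrm{EM}}_{p,m,\ell}(z)\,\tilde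 r_{m,\ell}$, which defines the internal stability polynomials $Q^{\mathrm{EM}}_{p,m,\ell}$. *)

theory Defs
  imports "HOL-Computational_Algebra.Polynomial"
begin

text \<open>
  One perturbed step of the explicit midpoint extrapolation method on \<open>U' = \<lambda> U\<close>, with
  \<open>z = \<tau> \<lambda>\<close>, initial value \<open>U\<close> and residuals \<open>\<rho> m j\<close>.
\<close>

fun em_Y :: "complex \<Rightarrow> complex \<Rightarrow> (nat \<Rightarrow> nat \<Rightarrow> complex) \<Rightarrow> nat \<Rightarrow> nat \<Rightarrow> complex" where
  "em_Y z U \<rho> m 0 = U"
| "em_Y z U \<rho> m (Suc 0) = (1 + z / (2 * of_nat m)) * em_Y z U \<rho> m 0 + \<rho> m (Suc 0)"
| "em_Y z U \<rho> m (Suc (Suc j)) =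
     em_Y z U \<rho> m j + z / of_nat m * em_Y z U \<rho> m (Suc j) + \<rho> m (Suc (Suc j))"

text \<open>Only the entries \<open>T j k\<close> with \<open>1 \<le> k \<le> j\<close> are meaningful; column \<open>0\<close> is a dummy.\<close>

fun em_T :: "complex \<Rightarrow> complex \<Rightarrow> (nat \<Rightarrow> nat \<Rightarrow> complex) \<Rightarrow> nat \<Rightarrow> nat \<Rightarrow> complex" where
  "em_T z U \<rho> j 0 = 0"
| "em_T z U \<rho> j (Suc 0) = em_Y z U \<rho> j (2 * j)"
| "em_T z U \<rho> j (Suc (Suc k)) =
     em_T z U \<rho> j (Suc k) +
     (em_T z U \<rho> j (Suc k) - em_T z U \<rho> (j - 1) (Suc k)) /
       ((of_nat j)\<^sup>2 / (of_nat j - of_nat (Suc (Suc k)) + 1)\<^sup>2 - 1)"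

definition em_step :: "nat \<Rightarrow> complex \<Rightarrow> complex \<Rightarrow> (nat \<Rightarrow> nat \<Rightarrow> complex) \<Rightarrow> complex" where
  "em_step p z U \<rho> = em_T z U \<rho> (p div 2) (p div 2)"

definition em_represents ::
    "nat \<Rightarrow> complex poly \<Rightarrow> (nat \<Rightarrow> nat \<Rightarrow> complex poly) \<Rightarrow> bool" where
  "em_represents p P Q \<longleftrightarrow>
     (\<forall>z U \<rho>. em_step p z U \<rho> =
        poly P z * U + (\<Sum>m = 1..p div 2. \<Sum>l = 1..2 * m. poly (Q m l) z * \<rho> m l))"

text \<open>
  The representation determines \<open>Q m l\<close> exactly for \<open>1 \<le> m \<le> p div 2\<close>, \<open>1 \<le> l \<le> 2 * m\<close>,
  so the description below is taken entrywise rather than for the whole family.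
\<close>

definition em_Q :: "nat \<Rightarrow> nat \<Rightarrow> nat \<Rightarrow> complex poly" where
  "em_Q p m l = (THE q. \<exists>P Q. em_represents p P Q \<and> q = Q m l)"

fun em_q :: "nat \<Rightarrow> nat \<Rightarrow> complex poly" where
  "em_q m 0 = 0"
| "em_q m (Suc 0) = 1"
| "em_q m (Suc (Suc j)) = [:0, 1 / of_nat m:] * em_q m (Suc j) + em_q m j"

end

theory Submission
  imports Defs
begin

text \<open>
  The map from the residuals to the new value is a composition of two linear maps, and each of them
  can be written down explicitly.

  First, in a single row \<open>m\<close> the residual \<open>\<rho> m l\<close> enters at stage \<open>l\<close> with factor \<open>1\<close> and is then
  propagated by the two-step midpoint recurrence.  The polynomials \<open>em_q m\<close> are the solution
  of this recurrence started from \<open>0, 1\<close>, so that stage \<open>j\<close> contains \<open>\<rho> m l\<close> with the factor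
  \<open>em_q m (j - l + 1)\<close>; for the last stage \<open>j = 2 * m\<close> this gives the polynomial of the theorem
  (\<open>em_Y_expansion\<close>).

  Second, the tableau is the Aitken--Neville scheme which evaluates at \<open>0\<close> the polynomial interpolating
  the row results at the nodes \<open>1 / m\<^sup>2\<close>.  Hence an entry is the combination of row results
  whose weights are the Lagrange basis polynomials at \<open>0\<close>, which in terms of the reciprocal
  nodes are the products of the factors \<open>m\<^sup>2 / (m\<^sup>2 - i\<^sup>2)\<close> (\<open>em_T_expansion\<close>).  For the nodes
  \<open>1, \<dots>, r\<close> the product is an expression in factorials, because
  \<open>m\<^sup>2 - i\<^sup>2 = (m - i) * (m + i)\<close> (\<open>square_node_weight\<close>).

  Together these expansions give one family of polynomials representing the step.  Feeding in a single
  unit residual shows that it is the only one (\<open>em_represents_unique\<close>).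
\<close>

section \<open>Extrapolation weights\<close>

text \<open>
  With \<open>x i = 1 / t i\<close> this is \<open>\<Prod>i\<in>S - {m}. t i / (t i - t m)\<close>, the value at \<open>0\<close> of the Lagrange
  basis polynomial for the node \<open>t m\<close>.
\<close>

definition neville_weight :: "('i \<Rightarrow> 'a::field) \<Rightarrow> 'i set \<Rightarrow> 'i \<Rightarrow> 'a" where
  "neville_weight x S m = (\<Prod>i\<in>S - {m}. x m / (x m - x i))"

lemma neville_weight_singleton [simp]: "neville_weight x {m} m = 1"
  by (simp add: neville_weight_def)

lemma neville_weight_insert:
  assumes "finite S" "a \<notin> S" "a \<noteq> m"
  shows "neville_weight x (insert a S) m = x m / (x m - x a) * neville_weight x S m"
proof -
  have "insert a S - {m} = insert a (S - {m})"
    using assms by auto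
  then show ?thesis
    using assms by (simp add: neville_weight_def)
qed

text \<open>
  The Aitken--Neville step.  An old node \<open>m \<in> S\<close> occurs in both combinations, and its
  coefficient is right because of
  \<open>x b / (x m - x b) - x a / (x m - x a) = (x b - x a) * x m / ((x m - x a) * (x m - x b))\<close>.
  The nodes \<open>a\<close> and \<open>b\<close> occur in only one combination, where the factor of the step is already
  the missing factor of the weight.
\<close>

lemma neville_step:
  fixes x f :: "'i \<Rightarrow> 'a::field"
  assumes fin: "finite S" and a: "a \<notin> S" and b: "b \<notin> S" and ab: "a \<noteq> b"
    and inj: "inj_on x (insert a (insert b S))" and nz: "x a \<noteq> 0"
  defines "E \<equiv> \<lambda>S. \<Sum>m\<in>S. neville_weight x S m * f m"
  shows "E (insert b S) + (E (insert b S) - E (insert a S)) / (x b / x a - 1)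
           = E (insert a (insert b S))"
proof -
  let ?w = "neville_weight x"
  have d: "x b - x a \<noteq> 0"
    using inj ab by (auto simp: inj_on_def)
  have E_b: "E (insert b S) = ?w (insert b S) b * f b + (\<Sum>m\<in>S. ?w (insert b S) m * f m)"
    using fin b by (simp add: E_def)
  have E_a: "E (insert a S) = ?w (insert a S) a * f a + (\<Sum>m\<in>S. ?w (insert a S) m * f m)"
    using fin a by (simp add: E_def)
  have "E (insert b S) + (E (insert b S) - E (insert a S)) / (x b / x a - 1)
      = (x b * E (insert b S) - x a * E (insert a S)) / (x b - x a)"
    using nz d by (simp add: field_simps)
  also have "(x b * E (insert b S) - x a * E (insert a S)) / (x b - x a)
      = x a / (x a - x b) * ?w (insert a S) a * f a + (x b / (x b - x a) * ?w (insert b S) b * f b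
        + (\<Sum>m\<in>S. (x b * ?w (insert b S) m - x a * ?w (insert a S) m) / (x b - x a) * f m))"
  proof -
    have "(\<Sum>m\<in>S. (x b * ?w (insert b S) m - x a * ?w (insert a S) m) / (x b - x a) * f m)
        = (x b * (\<Sum>m\<in>S. ?w (insert b S) m * f m) - x a * (\<Sum>m\<in>S. ?w (insert a S) m * f m))
            / (x b - x a)"
      by (simp add: sum_distrib_left sum_subtractf [symmetric] sum_divide_distrib algebra_simps)
    moreover have "x a / (x a - x b) = - (x a / (x b - x a))"
      by (metis minus_diff_eq divide_minus_right)
    ultimately show ?thesis
      unfolding E_a E_b by (simp add: add_divide_distrib diff_divide_distrib algebra_simps)
  qed
  also have "(\<Sum>m\<in>S. (x b * ?w (insert b S) m - x a * ?w (insert a S) m) / (x b - x a) * f m)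
      = (\<Sum>m\<in>S. ?w (insert a (insert b S)) m * f m)"
  proof (rule sum.cong [OF refl])
    fix m assume m: "m \<in> S"
    have ne: "a \<noteq> m" "b \<noteq> m" "x m - x a \<noteq> 0" "x m - x b \<noteq> 0"
      using m a b inj by (auto simp: inj_on_def)
    have "(x b * (x m / (x m - x b)) - x a * (x m / (x m - x a))) / (x b - x a)
        = x m / (x m - x a) * (x m / (x m - x b))"
      using ne d by (simp add: divide_simps) (simp add: algebra_simps)
    then have "(x b * (x m / (x m - x b)) - x a * (x m / (x m - x a))) / (x b - x a) * ?w S m
        = x m / (x m - x a) * (x m / (x m - x b)) * ?w S m"
      by (rule arg_cong)
    then show "(x b * ?w (insert b S) m - x a * ?w (insert a S) m) / (x b - x a) * f m
        = ?w (insert a (insert b S)) m * f m"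
      using ne a b ab fin
      by (simp add: neville_weight_insert left_diff_distrib diff_divide_distrib algebra_simps)
  qed
  also have "x a / (x a - x b) * ?w (insert a S) a = ?w (insert a (insert b S)) a"
    using neville_weight_insert [of "insert a S" b a x] fin b ab by (simp add: insert_commute)
  also have "x b / (x b - x a) * ?w (insert b S) b = ?w (insert a (insert b S)) b"
    using neville_weight_insert [of "insert b S" a b x] fin a ab by simp
  also have "?w (insert a (insert b S)) a * f a + (?w (insert a (insert b S)) b * f b
        + (\<Sum>m\<in>S. ?w (insert a (insert b S)) m * f m)) = E (insert a (insert b S))"
    using fin a b ab by (simp add: E_def)
  finally show ?thesis .
qed

abbreviation square_node :: "nat \<Rightarrow> complex" where
  "square_node i \<equiv> (of_nat i)\<^sup>2"

lemma inj_square_node: "inj square_node"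
proof (rule injI)
  fix i j :: nat assume "square_node i = square_node j"
  then have "(of_nat (i\<^sup>2) :: complex) = of_nat (j\<^sup>2)"
    by simp
  then have "i\<^sup>2 = j\<^sup>2"
    by (simp only: of_nat_eq_iff)
  then show "i = j"
    by (simp add: power2_eq_iff_nonneg)
qed

text \<open>
  Induction on \<open>r\<close> starting from \<open>r = m\<close>: the additional node \<open>r + 1\<close> contributes the factor
  \<open>m\<^sup>2 / (m\<^sup>2 - (r + 1)\<^sup>2)\<close>, whose denominator is \<open>- (r + 1 - m) * (r + 1 + m)\<close> and extends
  both factorials by one.
\<close>

lemma square_node_weight:
  assumes "1 \<le> m" "m \<le> r"
  shows "neville_weight square_node {1..r} m
           = 2 * (-1) ^ (m + r) * of_nat m ^ (2 * r) / (fact (r - m) * fact (r + m))"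
  using \<open>m \<le> r\<close>
proof (induction r rule: dec_induct)
  case base
  \<comment> \<open>All other nodes are below \<open>m\<close>; multiplying up the first \<open>n\<close> of them keeps every factor
      \<open>m - i\<close> positive, so the two factorials can be peeled off one step at a time.\<close>
  have partial: "(\<Prod>i = 1..n. square_node m / (square_node m - square_node i))
      = of_nat m ^ (2 * n) * of_nat m * fact (m - 1 - n) / (fact (m + n) :: complex)"
    if "n < m" for n
    using that
  proof (induction n)
    case 0
    then show ?case using fact_reduce [of m, where ?'a = complex] by simp
  next
    case (Suc n)
    define c where "c = m - 1 - Suc n"
    have m: "m = c + n + 2" and c: "m - 1 - n = Suc c"
      using Suc.prems by (auto simp: c_def)
    have m': "(of_nat m :: complex) = of_nat c + of_nat n + 2"
      by (simp add: m)
    have "square_node m - square_node (Suc n) = of_nat (Suc c) * of_nat (m + Suc n)"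
      by (simp add: m' power2_eq_square algebra_simps)
    moreover have "(of_nat (Suc c) :: complex) \<noteq> 0" "(of_nat (m + Suc n) :: complex) \<noteq> 0"
      by (simp_all only: of_nat_eq_0_iff)
    moreover have "fact (m - 1 - n) = (of_nat (Suc c) * fact c :: complex)"
      by (simp only: c fact_Suc)
    moreover have "fact (m + Suc n) = (of_nat (m + Suc n) * fact (m + n) :: complex)"
      by (simp only: add_Suc_right fact_Suc)
    moreover have "(\<Prod>i = 1..Suc n. square_node m / (square_node m - square_node i))
      = (\<Prod>i = 1..n. square_node m / (square_node m - square_node i))
        * (square_node m / (square_node m - square_node (Suc n)))"
      by simp
    ultimately show ?case
      using Suc c_def
      by (simp add: power2_eq_square mult_ac del: of_nat_Suc of_nat_add)
  qed
  obtain n where n: "m = Suc n"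
    using assms(1) by (cases m) auto
  have set: "{1..m} - {m} = {1..n}"
    using n by auto
  have double: "fact (m + m) = (2 * of_nat m * fact (m + n) :: complex)"
    by (simp add: n)
  have nz: "(of_nat m :: complex) \<noteq> 0"
    using assms(1) by simp
  have pow: "(of_nat m :: complex) ^ (2 * m) = of_nat m ^ (2 * n) * of_nat m * of_nat m"
    by (simp add: n)
  have "neville_weight square_node {1..m} m
      = of_nat m ^ (2 * n) * of_nat m / fact (m + n)"
    using partial [of n] n unfolding neville_weight_def set by simp
  also have "\<dots> = 2 * of_nat m ^ (2 * m) / fact (m + m)"
    unfolding double pow using nz by simp
  finally show ?case
    by simp
next
  case (step r)
  define d where "d = r - m"
  have r: "r = m + d" and d: "Suc r - m = Suc d"
    using step.hyps by (auto simp: d_def)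
  have "neville_weight square_node {1..Suc r} m
      = square_node m / (square_node m - square_node (Suc r)) * neville_weight square_node {1..r} m"
    using neville_weight_insert [of "{1..r}" "Suc r" m square_node] step.hyps
    by (simp add: atLeastAtMostSuc_conv)
  also have "square_node m - square_node (Suc r) = - (of_nat (Suc d) * of_nat (Suc (r + m)))"
    by (simp add: r power2_eq_square algebra_simps)
  also note step.IH
  finally show ?case
    by (simp add: mult_ac d d_def [symmetric] power2_eq_square del: of_nat_Suc of_nat_add)
qed

section \<open>Expansion of one step\<close>

text \<open>
  The two predecessors of an entry depend on the same rows except that the first one or the
  last one is missing, and the correction divides by the ratio of the nodes of these two rows
  minus \<open>1\<close>; so every column is an instance of the Aitken--Neville step.
\<close>

lemma em_T_expansion:
  "k < j \<Longrightarrow> em_T z U \<rho> j (Suc k)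
     = (\<Sum>m = j - k..j. neville_weight square_node {j - k..j} m * em_Y z U \<rho> m (2 * m))"
proof (induction k arbitrary: j)
  case 0
  then show ?case by simp
next
  case (Suc k)
  let ?S = "{j - k..j - 1}" and ?a = "j - Suc k"
  have sets: "{j - k..j} = insert j ?S" "{j - 1 - k..j - 1} = insert ?a ?S"
      "{j - Suc k..j} = insert ?a (insert j ?S)"
    using Suc.prems by auto
  have node: "of_nat j - of_nat (Suc (Suc k)) + 1 = (of_nat ?a :: complex)"
    using Suc.prems by (simp add: of_nat_diff algebra_simps)
  have nz: "square_node ?a \<noteq> 0"
    using Suc.prems by (simp del: of_nat_diff)
  have "em_T z U \<rho> j (Suc (Suc k)) = em_T z U \<rho> j (Suc k)
      + (em_T z U \<rho> j (Suc k) - em_T z U \<rho> (j - 1) (Suc k)) / (square_node j / square_node ?a - 1)"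
    by (simp only: em_T.simps node)
  also have "em_T z U \<rho> j (Suc k)
      = (\<Sum>m\<in>insert j ?S. neville_weight square_node (insert j ?S) m * em_Y z U \<rho> m (2 * m))"
    using Suc.IH [of j] Suc.prems unfolding sets by simp
  also have "em_T z U \<rho> (j - 1) (Suc k)
      = (\<Sum>m\<in>insert ?a ?S. neville_weight square_node (insert ?a ?S) m * em_Y z U \<rho> m (2 * m))"
    using Suc.IH [of "j - 1"] Suc.prems unfolding sets by simp
  finally show ?case
    unfolding sets
    using Suc.prems nz inj_on_subset [OF inj_square_node subset_UNIV]
    by (subst neville_step [symmetric]) (simp_all del: of_nat_diff)
qed

text \<open>
  Only the contribution of \<open>U\<close> sees the Euler starting step, whose factor \<open>z / (2 * m)\<close> differs from
  that of the other stages.  The contributions of the residuals satisfy the recurrence of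
  \<open>em_q\<close> throughout; \<open>em_q m 0 = 0\<close> makes it valid also at the stage following the one where the
  residual enters.
\<close>

lemma em_Y_expansion:
  "em_Y z U \<rho> m j = em_Y z 1 (\<lambda>_ _. 0) m j * U
     + (\<Sum>l = 1..j. poly (em_q m (j - l + 1)) z * \<rho> m l)"
proof (induction j rule: induct_nat_012)
  case 0
  then show ?case by simp
next
  case 1
  then show ?case by simp
next
  case (ge2 j)
  have recurrence: "poly (em_q m (Suc (Suc j) - l + 1)) z =
      z / of_nat m * poly (em_q m (Suc j - l + 1)) z + poly (em_q m (j - l + 1)) z"
    if "l \<in> {1..j}" for l
  proof -
    have "Suc (Suc j) - l + 1 = Suc (Suc (j - l + 1))" "Suc j - l + 1 = Suc (j - l + 1)"
      using that by auto
    then show ?thesis by simp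
  qed
  have "(\<Sum>l = 1..Suc (Suc j). poly (em_q m (Suc (Suc j) - l + 1)) z * \<rho> m l)
      = (\<Sum>l = 1..j. (z / of_nat m * poly (em_q m (Suc j - l + 1)) z
           + poly (em_q m (j - l + 1)) z) * \<rho> m l)
        + z / of_nat m * \<rho> m (Suc j) + \<rho> m (Suc (Suc j))"
    using recurrence by simp
  also have "\<dots>
      = z / of_nat m * (\<Sum>l = 1..Suc j. poly (em_q m (Suc j - l + 1)) z * \<rho> m l)
        + (\<Sum>l = 1..j. poly (em_q m (j - l + 1)) z * \<rho> m l) + \<rho> m (Suc (Suc j))"
    by (simp add: sum_distrib_left sum.distrib algebra_simps)
  finally show ?case
    by (simp only: em_Y.simps ge2 distrib_left distrib_right mult.assoc add.assoc
        add.left_commute add.commute add_0_left mult_zero_left)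
qed

text \<open>
  The factor of \<open>U\<close> in the expansion enters only the stability polynomial of the step, for which
  its being a polynomial in \<open>z\<close> is enough.
\<close>

lemma em_Y_polynomial: "\<exists>A. \<forall>z. em_Y z 1 (\<lambda>_ _. 0) m j = poly A z"
proof (induction j rule: induct_nat_012)
  case 0
  then show ?case by (intro exI [of _ 1]) simp
next
  case 1
  then show ?case by (intro exI [of _ "[:1, 1 / (2 * of_nat m):]"]) simp
next
  case (ge2 j)
  then obtain A B where "\<forall>z. em_Y z 1 (\<lambda>_ _. 0) m j = poly A z"
      "\<forall>z. em_Y z 1 (\<lambda>_ _. 0) m (Suc j) = poly B z"
    by auto
  then show ?case
    by (intro exI [of _ "A + [:0, 1 / of_nat m:] * B"]) simp
qed

lemma em_represents_explicit:
  "\<exists>P. em_represents p P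
     (\<lambda>m l. smult (neville_weight square_node {1..p div 2} m) (em_q m (2 * m - l + 1)))"
proof -
  define r where "r = p div 2"
  let ?w = "neville_weight square_node {1..r}"
  obtain A where A: "\<And>m z. em_Y z 1 (\<lambda>_ _. 0) m (2 * m) = poly (A m) z"
  proof -
    have "\<exists>A. \<forall>m z. em_Y z 1 (\<lambda>_ _. 0) m (2 * m) = poly (A m) z"
      by (rule choice) (rule allI, rule em_Y_polynomial)
    then show ?thesis
      using that by blast
  qed
  have row: "em_Y z U \<rho> m (2 * m)
      = poly (A m) z * U + (\<Sum>l = 1..2 * m. poly (em_q m (2 * m - l + 1)) z * \<rho> m l)" for z U \<rho> m
    unfolding A [symmetric] by (rule em_Y_expansion)
  have step: "em_step p z U \<rho> = (\<Sum>m = 1..r. ?w m * em_Y z U \<rho> m (2 * m))" for z U \<rho>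
  proof (cases r)
    case 0
    then show ?thesis by (simp add: em_step_def r_def [symmetric])
  next
    case (Suc k)
    then show ?thesis
      using em_T_expansion [of k r z U \<rho>] by (simp add: em_step_def r_def [symmetric])
  qed
  have "em_represents p (\<Sum>m = 1..r. smult (?w m) (A m))
      (\<lambda>m l. smult (?w m) (em_q m (2 * m - l + 1)))"
    unfolding em_represents_def r_def [symmetric] step row
    by (simp add: poly_sum sum_distrib_left sum_distrib_right sum.distrib algebra_simps)
  then show ?thesis
    unfolding r_def by blast
qed

section \<open>The internal stability polynomials\<close>

text \<open>
  With \<open>U = 0\<close> and a single unit residual in position \<open>(m, l)\<close>, the step returns the
  value of \<open>Q m l\<close> at \<open>z\<close>; a complex polynomial is determined by its values.
\<close>

lemma em_represents_unique:
  assumes rep: "em_represents p P Q" "em_represents p P' Q'"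
    and m: "m \<in> {1..p div 2}" and l: "l \<in> {1..2 * m}"
  shows "Q m l = Q' m l"
proof -
  have probe: "em_step p z 0 (\<lambda>i j. if i = m \<and> j = l then 1 else 0) = poly (Q m l) z"
    if "em_represents p P Q" for P Q z
  proof -
    have "(\<Sum>i = 1..p div 2. \<Sum>j = 1..2 * i. poly (Q i j) z * (if i = m \<and> j = l then 1 else 0))
        = (\<Sum>i = 1..p div 2. if i = m then poly (Q m l) z else 0)"
    proof (rule sum.cong [OF refl])
      fix i
      show "(\<Sum>j = 1..2 * i. poly (Q i j) z * (if i = m \<and> j = l then 1 else 0))
          = (if i = m then poly (Q m l) z else 0)"
        using l by (simp add: if_distrib cong: if_cong)
    qed
    also have "\<dots> = poly (Q m l) z"
      using m by simp
    finally show ?thesis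
      using that by (simp add: em_represents_def)
  qed
  have "poly (Q m l) = poly (Q' m l)"
    using probe [OF rep(1)] probe [OF rep(2)] by auto
  then show ?thesis
    by (simp add: poly_eq_poly_eq_iff)
qed

theorem lemma4p5:
  fixes p r m l :: nat and z :: complex
  assumes "even p" and "p \<ge> 2" and "r = p div 2"
    and "1 \<le> m" and "m \<le> r" and "1 \<le> l" and "l \<le> 2 * m"
  shows "poly (em_Q p m l) z =
           2 * (-1) ^ (m + r) * of_nat m ^ (2 * r) / (fact (r - m) * fact (r + m)) *
           poly (em_q m (2 * m - l + 1)) z"
proof -
  let ?Q = "\<lambda>m l. smult (neville_weight square_node {1..p div 2} m) (em_q m (2 * m - l + 1))"
  obtain P where P: "em_represents p P ?Q"
    using em_represents_explicit by blast
  have range: "m \<in> {1..p div 2}" "l \<in> {1..2 * m}"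
    using assms by auto
  have "em_Q p m l = ?Q m l"
    unfolding em_Q_def
  proof (rule the_equality)
    show "\<exists>P Q. em_represents p P Q \<and> ?Q m l = Q m l"
      using P by blast
    show "q = ?Q m l" if "\<exists>P Q. em_represents p P Q \<and> q = Q m l" for q
      using that em_represents_unique [OF _ P range] by blast
  qed
  then show ?thesis
    using square_node_weight [of m r] assms by simp
qed

end
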